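(* Let $X=c_0$ or $X=\ell_p$ with $1\leq p\leq\infty$. Let $T\in\mathcal{L}(X)$ be a norm one operator defined as $$Tx=(\alpha_n x(n))_{n=1}^\infty\qquad (x=(x(n))_{n=1}^\infty\in X),$$ where $(\alpha_n)_{n=1}^\infty$ is a bounded sequence of complex numbers. Then the following assertions are equivalent: (a) $T\in\mathcal{A}_{\|\cdot\|}(X,X)$. (b) Both of these conditions are satisfied: (1) there exists some $n_0\in\mathbb{N}$ such that $|\alpha_{n_0}|=1$; (2) if $J=\{n\in\mathbb{N}:|\alpha_n|=1\}$, then either $J=\mathbb{N}$ or $\sup_{n\in\mathbb{N}\setminus J}|\alpha_n|<1$.
   Context: $c_0$ and $\ell_p$ are the usual sequence spaces (if they are taken over $\mathbb{R}$, the $\alpha_n$ are real, so that $T$ maps $X$ to $X$). $S_X$ is the unit sphere of a Banach space $X$, $\mathcal{L}(X,Y)$ the bounded linear operators from $X$ to $Y$, and $\mathcal{L}(X)=\mathcal{L}(X,X)$. An operator $T\in\mathcal{L}(X,Y)$ attains its norm if $\|T(x_0)\|=\|T\|$ for some $x_0\in S_X$. $\mathcal{A}_{\|\cdot\|}(X,Y)$ is the set of all norm-attaining $T\in\mathcal{L}(X,Y)$ with $\|T\|=1$ such that for every $\varepsilon>0$ there is $\eta(\varepsilon,T)>0$ such that whenever $x\in S_X$ satisfies $\|T(x)\|>1-\eta(\varepsilon,T)$, there is $x_0\in S_X$ with $\|T(x_0)\|=1$ and $\|x_0-x\|<\varepsilon$. *)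

theory Defs
  imports "HOL-Analysis.Analysis" "HOL-Library.Function_Algebras" "HOL-Library.Extended_Real"
begin

text \<open>
  A normed space over the scalars \<open>'k\<close> is presented inside an ambient additive group \<open>'v\<close>: a carrier,
  a scalar multiplication and a norm, the last two being relevant on the carrier only. Carriers
  rather than types are used because the spaces below depend on the exponent \<open>p\<close>.

  The scalar field of the sequence spaces is any \<open>'a :: real_normed_field\<close>. Both \<open>real\<close> and
  \<open>complex\<close> are instances and, by the Gelfand--Mazur theorem, the only ones up to isometric
  isomorphism.
\<close>

record ('k, 'v) nspace =
  vecs :: "'v set"
  smul :: "'k \<Rightarrow> 'v \<Rightarrow> 'v"
  nrm  :: "'v \<Rightarrow> real"

definition unit_sphere :: "('k, 'v) nspace \<Rightarrow> 'v set" where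
  "unit_sphere X = {x \<in> vecs X. nrm X x = 1}"

definition bounded_operators ::
  "('k, 'v::ab_group_add) nspace \<Rightarrow> ('k, 'w::ab_group_add) nspace \<Rightarrow> ('v \<Rightarrow> 'w) set" where
  "bounded_operators X Y = {T.
     (\<forall>x\<in>vecs X. T x \<in> vecs Y) \<and>
     (\<forall>x\<in>vecs X. \<forall>y\<in>vecs X. T (x + y) = T x + T y) \<and>
     (\<forall>c. \<forall>x\<in>vecs X. T (smul X c x) = smul Y c (T x)) \<and>
     (\<exists>K. \<forall>x\<in>vecs X. nrm Y (T x) \<le> K * nrm X x)}"

definition op_norm :: "('k, 'v) nspace \<Rightarrow> ('k, 'w) nspace \<Rightarrow> ('v \<Rightarrow> 'w) \<Rightarrow> real" where
  "op_norm X Y T = (SUP x\<in>{x \<in> vecs X. nrm X x \<le> 1}. nrm Y (T x))"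

definition attains_norm :: "('k, 'v) nspace \<Rightarrow> ('k, 'w) nspace \<Rightarrow> ('v \<Rightarrow> 'w) \<Rightarrow> bool" where
  "attains_norm X Y T \<longleftrightarrow> (\<exists>x0\<in>unit_sphere X. nrm Y (T x0) = op_norm X Y T)"

definition A_norm ::
  "('k, 'v::ab_group_add) nspace \<Rightarrow> ('k, 'w::ab_group_add) nspace \<Rightarrow> ('v \<Rightarrow> 'w) set" where
  "A_norm X Y = {T \<in> bounded_operators X Y. attains_norm X Y T \<and> op_norm X Y T = 1 \<and>
     (\<forall>\<epsilon>>0. \<exists>\<eta>>0. \<forall>x\<in>unit_sphere X. nrm Y (T x) > 1 - \<eta> \<longrightarrow>
        (\<exists>x0\<in>unit_sphere X. nrm Y (T x0) = 1 \<and> nrm X (x0 - x) < \<epsilon>))}"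

text \<open>Sequences are indexed from \<open>0\<close>.\<close>

definition c0_space :: "('a::real_normed_field, nat \<Rightarrow> 'a) nspace" where
  "c0_space = \<lparr>vecs = {x. x \<longlonglongrightarrow> 0},
     smul = (\<lambda>c x n. c * x n),
     nrm = (\<lambda>x. SUP n. norm (x n))\<rparr>"

definition lp_space :: "ereal \<Rightarrow> ('a::real_normed_field, nat \<Rightarrow> 'a) nspace" where
  "lp_space p = (if p = \<infinity>
     then \<lparr>vecs = {x. bounded (range x)},
       smul = (\<lambda>c x n. c * x n),
       nrm = (\<lambda>x. SUP n. norm (x n))\<rparr>
     else \<lparr>vecs = {x. summable (\<lambda>n. norm (x n) powr real_of_ereal p)},
       smul = (\<lambda>c x n. c * x n),
       nrm = (\<lambda>x. (\<Sum>n. norm (x n) powr real_of_ereal p) powr (1 / real_of_ereal p))\<rparr>)"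

end

theory Submission imports Defs begin

text \<open>
  If \<open>|\<alpha> n| < 1\<close> for some \<open>n\<close>, no norm-one vector close to the unit vector \<open>e\<^sub>n\<close> has an image of norm
  one. Hence \<open>|\<alpha>|\<close> cannot come close to \<open>1\<close> off the set \<open>J\<close> where it equals \<open>1\<close>; and \<open>J\<close> is nonempty
  since otherwise \<open>T\<close> would be a strict contraction. Conversely, if \<open>|\<alpha>| \<le> \<beta> < 1\<close> off \<open>J\<close>, then a
  vector \<open>x\<close> that nearly attains the norm has most of its mass on \<open>J\<close>: for the supremum norm some
  coordinate in \<open>J\<close> is nearly of modulus one and can be normalised, and for the \<open>p\<close>-norm
  the restriction of \<open>x\<close> to \<open>J\<close> can be normalised.
\<close>

section \<open>Diagonal operators on an abstract sequence space\<close>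

definition unit_seq :: "nat \<Rightarrow> nat \<Rightarrow> 'a::zero_neq_one" where
  "unit_seq n = (\<lambda>m. if m = n then 1 else 0)"

text \<open>These properties are all that the equivalence needs from the space, so the supremum norm
  and the \<open>p\<close>-norm can be handled separately. \<open>rigid\<close> yields the gap below
  1 off \<open>J\<close>, \<open>contraction\<close> the nonemptiness of \<open>J\<close>, and
  \<open>approx\<close> the converse. \<open>rigid\<close> asks only for coordinatewise closeness,
  which \<open>coord_diff_le\<close> extracts from closeness in norm.\<close>

locale diagonal_space =
  fixes X :: "('a::real_normed_field, nat \<Rightarrow> 'a) nspace"
  assumes unit_seq_vecs: "unit_seq n \<in> vecs X"
    and nrm_unit_seq: "nrm X (\<lambda>m. c * unit_seq n m) = norm c"
    and coord_diff_le: "x \<in> vecs X \<Longrightarrow> y \<in> vecs X \<Longrightarrow> norm (x n - y n) \<le> nrm X (x - y)"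
    and nrm_nonneg: "x \<in> vecs X \<Longrightarrow> 0 \<le> nrm X x"
    and contraction: "x \<in> vecs X \<Longrightarrow> 0 \<le> \<beta> \<Longrightarrow> (\<And>n. norm (\<alpha> n) \<le> \<beta>) \<Longrightarrow>
      nrm X (\<lambda>n. \<alpha> n * x n) \<le> \<beta> * nrm X x"
    and rigid: "x \<in> unit_sphere X \<Longrightarrow> (\<And>m. norm (\<alpha> m) \<le> 1) \<Longrightarrow> norm (\<alpha> n) < 1 \<Longrightarrow>
      (\<And>m. norm (x m - unit_seq n m) \<le> 1/2) \<Longrightarrow> nrm X (\<lambda>m. \<alpha> m * x m) < 1"
    and approx: "(\<And>n. norm (\<alpha> n) = 1 \<or> norm (\<alpha> n) \<le> \<beta>) \<Longrightarrow> 0 \<le> \<beta> \<Longrightarrow> \<beta> < 1 \<Longrightarrow> 0 < \<epsilon> \<Longrightarrow>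
      \<exists>\<eta>>0. \<forall>x\<in>unit_sphere X. nrm X (\<lambda>n. \<alpha> n * x n) > 1 - \<eta> \<longrightarrow>
        (\<exists>x0\<in>unit_sphere X. nrm X (\<lambda>n. \<alpha> n * x0 n) = 1 \<and> nrm X (x0 - x) < \<epsilon>)"
begin

lemma unit_seq_sphere: "unit_seq n \<in> unit_sphere X"
  using nrm_unit_seq[of 1 n] unit_seq_vecs by (simp add: unit_sphere_def)

lemma diagonal_A_norm_iff:
  assumes T: "T \<in> bounded_operators X X"
    and T_diag: "\<forall>x\<in>vecs X. T x = (\<lambda>n. \<alpha> n * x n)"
    and T_norm: "op_norm X X T = 1"
  shows "T \<in> A_norm X X \<longleftrightarrow>
    (\<exists>n0. norm (\<alpha> n0) = 1) \<and>
    (let J = {n. norm (\<alpha> n) = 1} in J = UNIV \<or> (SUP n\<in>UNIV - J. norm (\<alpha> n)) < 1)"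
proof -
  define J where "J = {n. norm (\<alpha> n) = 1}"
  \<comment> \<open>Each unit vector is an eigenvector with eigenvalue \<open>\<alpha> n\<close>;
    hence the scalar \<open>c\<close> in \<open>nrm_unit_seq\<close>.\<close>
  have T_unit: "nrm X (T (unit_seq n)) = norm (\<alpha> n)" for n
  proof -
    have "T (unit_seq n) = (\<lambda>m. \<alpha> n * unit_seq n m)"
      using T_diag unit_seq_vecs by (auto simp: unit_seq_def)
    then show ?thesis by (simp add: nrm_unit_seq)
  qed
  obtain K where K: "nrm X (T x) \<le> K * nrm X x" if "x \<in> vecs X" for x
    using T unfolding bounded_operators_def by blast
  \<comment> \<open>The definition of boundedness records no sign for \<open>K\<close>, hence the
    absolute value. A bound on the unit ball is required before the supremum in
    \<open>op_norm\<close> can serve as an upper bound.\<close>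
  have "nrm X (T x) \<le> \<bar>K\<bar>" if "x \<in> vecs X" "nrm X x \<le> 1" for x
  proof -
    have "K * nrm X x \<le> \<bar>K\<bar> * 1"
      using that nrm_nonneg by (intro mult_mono) auto
    with K[OF that(1)] show ?thesis by simp
  qed
  then have bdd: "bdd_above ((\<lambda>x. nrm X (T x)) ` {x \<in> vecs X. nrm X x \<le> 1})"
    by (intro bdd_aboveI2[where M = "\<bar>K\<bar>"]) auto
  have \<alpha>_le: "norm (\<alpha> n) \<le> 1" for n
  proof -
    have "nrm X (T (unit_seq n)) \<le> op_norm X X T"
      unfolding op_norm_def using unit_seq_sphere[of n]
      by (intro cSUP_upper bdd) (auto simp: unit_sphere_def)
    with T_unit T_norm show ?thesis by simp
  qed
  then have bdd\<alpha>: "bdd_above ((\<lambda>n. norm (\<alpha> n)) ` S)" for S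
    by (intro bdd_aboveI2[where M = 1]) auto
  have Tx: "T x = (\<lambda>n. \<alpha> n * x n)" if "x \<in> unit_sphere X" for x
    using that T_diag by (auto simp: unit_sphere_def)
  show ?thesis
    unfolding Let_def J_def[symmetric]
  proof (intro iffI)
    assume A: "T \<in> A_norm X X"
    \<comment> \<open>This comes first because the existence of \<open>n0\<close> relies on it: for
      empty \<open>J\<close> it bounds all \<open>norm (\<alpha> n)\<close> by some \<beta> < 1,
      which contradicts the attainment of the norm 1.\<close>
    have gap: "J = UNIV \<or> (SUP n\<in>UNIV - J. norm (\<alpha> n)) < 1"
    proof (rule ccontr)
      assume "\<not> ?thesis"
      then have ne: "UNIV - J \<noteq> {}" and sup: "1 \<le> (SUP n\<in>UNIV - J. norm (\<alpha> n))" by auto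
      \<comment> \<open>The tolerance 1/2 is the one built into \<open>rigid\<close>.\<close>
      obtain \<eta> where "\<eta> > 0" and \<eta>: "\<And>x. x \<in> unit_sphere X \<Longrightarrow> nrm X (T x) > 1 - \<eta> \<Longrightarrow>
          \<exists>x0\<in>unit_sphere X. nrm X (T x0) = 1 \<and> nrm X (x0 - x) < 1/2"
        using A unfolding A_norm_def by (force dest: spec[where x = "1/2"])
      have "1 - \<eta> < (SUP n\<in>UNIV - J. norm (\<alpha> n))" using sup \<open>\<eta> > 0\<close> by simp
      then obtain n where n: "n \<notin> J" "1 - \<eta> < norm (\<alpha> n)"
        using less_cSUP_iff[OF ne bdd\<alpha>] by auto
      obtain x0 where x0: "x0 \<in> unit_sphere X" "nrm X (T x0) = 1"
          "nrm X (x0 - unit_seq n) < 1/2"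
        using \<eta>[OF unit_seq_sphere[of n]] n T_unit by auto
      have "norm (x0 m - unit_seq n m) \<le> 1/2" for m
        using coord_diff_le[of x0 "unit_seq n" m] x0 unit_seq_vecs[of n]
        by (auto simp: unit_sphere_def)
      moreover have "norm (\<alpha> n) < 1" using n \<alpha>_le[of n] by (auto simp: J_def)
      ultimately have "nrm X (\<lambda>m. \<alpha> m * x0 m) < 1"
        using rigid[of x0 \<alpha> n] x0(1) \<alpha>_le by blast
      with x0 Tx show False by simp
    qed
    moreover have "\<exists>n0. norm (\<alpha> n0) = 1"
    proof (rule ccontr)
      assume "\<not> ?thesis"
      then have [simp]: "J = {}" by (auto simp: J_def)
      define \<beta> where "\<beta> = (SUP n. norm (\<alpha> n))"
      have "\<beta> < 1" using gap by (simp add: \<beta>_def)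
      have le: "norm (\<alpha> n) \<le> \<beta>" for n
        unfolding \<beta>_def by (intro cSUP_upper bdd\<alpha>) auto
      from le[of 0] have "0 \<le> \<beta>" using norm_ge_zero order_trans by blast
      obtain x where x: "x \<in> unit_sphere X" "nrm X (T x) = 1"
        using A T_norm by (auto simp: A_norm_def attains_norm_def)
      with contraction[of x \<beta> \<alpha>] le \<open>0 \<le> \<beta>\<close> \<open>\<beta> < 1\<close> Tx show False
        by (auto simp: unit_sphere_def)
    qed
    ultimately show "(\<exists>n0. norm (\<alpha> n0) = 1) \<and>
        (J = UNIV \<or> (SUP n\<in>UNIV - J. norm (\<alpha> n)) < 1)" by blast
  next
    assume b: "(\<exists>n0. norm (\<alpha> n0) = 1) \<and> (J = UNIV \<or> (SUP n\<in>UNIV - J. norm (\<alpha> n)) < 1)"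
    then obtain n0 where n0: "norm (\<alpha> n0) = 1" by blast
    have "attains_norm X X T"
      unfolding attains_norm_def using unit_seq_sphere T_unit n0 T_norm by metis
    \<comment> \<open>If \<open>J\<close> is everything, 0 is taken, since the supremum over the
      empty set has no useful value. Otherwise the supremum off \<open>J\<close> serves, and the
      maximum with 0 gives nonnegativity directly.\<close>
    moreover obtain \<beta> where \<beta>: "0 \<le> \<beta>" "\<beta> < 1" "\<And>n. norm (\<alpha> n) = 1 \<or> norm (\<alpha> n) \<le> \<beta>"
    proof (cases "J = UNIV")
      case True
      then have "norm (\<alpha> n) = 1" for n by (auto simp: J_def)
      then show ?thesis using that[of 0] by simp
    next
      case False
      let ?s = "SUP n\<in>UNIV - J. norm (\<alpha> n)"
      have "norm (\<alpha> n) = 1 \<or> norm (\<alpha> n) \<le> max 0 ?s" for n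
      proof (cases "n \<in> J")
        case False
        then have "norm (\<alpha> n) \<le> ?s" by (intro cSUP_upper bdd\<alpha>) auto
        then show ?thesis by (simp add: le_max_iff_disj)
      qed (simp add: J_def)
      then show ?thesis using that[of "max 0 ?s"] b False by auto
    qed
    have "\<exists>\<eta>>0. \<forall>x\<in>unit_sphere X. nrm X (T x) > 1 - \<eta> \<longrightarrow>
        (\<exists>x0\<in>unit_sphere X. nrm X (T x0) = 1 \<and> nrm X (x0 - x) < \<epsilon>)" if "\<epsilon> > 0" for \<epsilon>
      using approx[OF \<beta>(3,1,2) that] by (simp add: Tx)
    ultimately show "T \<in> A_norm X X"
      using T T_norm by (auto simp: A_norm_def)
  qed
qed

end

section \<open>The supremum norm: c_0 and l_infinity\<close>

text \<open>The norm-attaining neighbour of \<open>x\<close> differs from it in a single coordinate,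
  so the carrier only has to be closed under such changes; this covers both spaces at once.\<close>

lemma sup_diagonal_space:
  fixes X :: "('a::real_normed_field, nat \<Rightarrow> 'a) nspace"
  assumes nrm: "nrm X = (\<lambda>x. SUP n. norm (x n))"
    and bdd: "\<And>x. x \<in> vecs X \<Longrightarrow> bounded (range x)"
    and unit: "\<And>n. unit_seq n \<in> vecs X"
    and upd: "\<And>x n c. x \<in> vecs X \<Longrightarrow> x(n := c) \<in> vecs X"
  shows "diagonal_space X"
proof -
  \<comment> \<open>Stated for bounded sequences rather than carrier elements, because it is also
    applied to products with \<alpha>, whose membership in \<open>vecs X\<close> is not among the
    assumptions.\<close>
  have le_nrm: "norm (x n) \<le> nrm X x" if "bounded (range x)" for x n
    unfolding nrm using that bdd_above_norm[of "range x"]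
    by (intro cSUP_upper) (auto simp: image_image)
  have nrm_le: "nrm X x \<le> c" if "\<And>n. norm (x n) \<le> c" for x c
    unfolding nrm using that by (intro cSUP_least) auto
  have bddm: "bounded (range x)" if "\<And>n. norm (x n) \<le> c" for x :: "nat \<Rightarrow> 'a" and c
    using that by (auto simp: bounded_iff)
  show ?thesis
  proof
    show "nrm X (\<lambda>m. c * unit_seq n m) = norm c" for c n
    proof (rule antisym)
      show "nrm X (\<lambda>m. c * unit_seq n m) \<le> norm c"
        by (rule nrm_le) (simp add: unit_seq_def)
      have "bounded (range (\<lambda>m. c * unit_seq n m))"
        by (rule bddm[of _ "norm c"]) (simp add: unit_seq_def)
      from le_nrm[OF this, of n] show "norm c \<le> nrm X (\<lambda>m. c * unit_seq n m)"
        by (simp add: unit_seq_def)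
    qed
    show "norm (x n - y n) \<le> nrm X (x - y)" if "x \<in> vecs X" "y \<in> vecs X" for x y n
      using le_nrm[of "x - y" n] bounded_minus_comp[of x UNIV y] bdd that
      by (simp add: fun_diff_def)
    show "0 \<le> nrm X x" if "x \<in> vecs X" for x
      using le_nrm[OF bdd[OF that], of 0] norm_ge_zero order_trans by blast
    show "nrm X (\<lambda>n. \<alpha> n * x n) \<le> \<beta> * nrm X x"
      if "x \<in> vecs X" "0 \<le> \<beta>" "\<And>n. norm (\<alpha> n) \<le> \<beta>" for x \<alpha> \<beta>
      using that le_nrm[OF bdd] by (intro nrm_le) (auto simp: norm_mult intro!: mult_mono)
    show "nrm X (\<lambda>m. \<alpha> m * x m) < 1"
      if x: "x \<in> unit_sphere X" and \<alpha>: "\<And>m. norm (\<alpha> m) \<le> 1" "norm (\<alpha> n) < 1"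
        and near: "\<And>m. norm (x m - unit_seq n m) \<le> 1/2" for x \<alpha> n
    proof -
      have "norm (x m) \<le> 1" for m
        using x le_nrm[OF bdd, of x m] by (auto simp: unit_sphere_def)
      moreover have "norm (x m) \<le> 1/2" if "m \<noteq> n" for m
        using near[of m] that by (simp add: unit_seq_def)
      \<comment> \<open>At \<open>n\<close> the factor \<open>\<alpha> n\<close> makes the product
        small; at every other coordinate \<open>unit_seq n\<close> vanishes, so \<open>x\<close>
        itself is at most 1/2 there.\<close>
      ultimately have "norm (\<alpha> m * x m) \<le> max (norm (\<alpha> n)) (1/2)" for m
        using \<alpha>(1)[of m] mult_mono[of "norm (\<alpha> m)" 1 "norm (x m)" "1/2"]
          mult_left_le[of "norm (x m)" "norm (\<alpha> m)"]
        by (cases "m = n") (auto simp: norm_mult le_max_iff_disj)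
      from nrm_le[of "\<lambda>m. \<alpha> m * x m", OF this] show ?thesis using \<alpha>(2) by linarith
    qed
    show "\<exists>\<eta>>0. \<forall>x\<in>unit_sphere X. nrm X (\<lambda>n. \<alpha> n * x n) > 1 - \<eta> \<longrightarrow>
        (\<exists>x0\<in>unit_sphere X. nrm X (\<lambda>n. \<alpha> n * x0 n) = 1 \<and> nrm X (x0 - x) < \<epsilon>)"
      if \<alpha>: "\<And>n. norm (\<alpha> n) = 1 \<or> norm (\<alpha> n) \<le> \<beta>" and \<beta>: "0 \<le> \<beta>" "\<beta> < 1" and "0 < \<epsilon>"
      for \<alpha> \<beta> \<epsilon>
    \<comment> \<open>The bound \<open>(1 - \<beta>) / 2\<close> forces the nearly maximal
      coordinate into \<open>J\<close> and makes it nonzero. The bound \<open>\<epsilon>/2\<close>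
      controls its distance from modulus one, and leaves room for the strict inequality after taking
      the supremum.\<close>
    proof (intro exI[where x = "min (\<epsilon>/2) ((1 - \<beta>) / 2)"] conjI ballI impI)
      let ?\<eta> = "min (\<epsilon>/2) ((1 - \<beta>) / 2)"
      show "0 < ?\<eta>" using \<beta> \<open>0 < \<epsilon>\<close> by simp
      fix x assume x: "x \<in> unit_sphere X" and big: "1 - ?\<eta> < nrm X (\<lambda>n. \<alpha> n * x n)"
      have x1: "norm (x m) \<le> 1" for m
        using x le_nrm[OF bdd, of x m] by (auto simp: unit_sphere_def)
      obtain n where n: "1 - ?\<eta> < norm (\<alpha> n * x n)"
        using big nrm_le[of "\<lambda>n. \<alpha> n * x n" "1 - ?\<eta>"] by (meson not_le)
      have "norm (\<alpha> n * x n) \<le> norm (\<alpha> n)"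
        using mult_left_le[OF x1] by (simp add: norm_mult)
      then have "\<not> norm (\<alpha> n) \<le> \<beta>" using n \<beta> by (auto simp: min_def field_simps split: if_splits)
      then have \<alpha>n: "norm (\<alpha> n) = 1" using \<alpha> by blast
      then have xn: "1 - ?\<eta> < norm (x n)" using n by (simp add: norm_mult)
      then have "x n \<noteq> 0" using \<beta> by (auto simp: min_def field_simps split: if_splits)
      \<comment> \<open>Normalising in the direction of \<open>x n\<close> moves this coordinate by
        exactly \<open>1 - norm (x n)\<close>.\<close>
      define x0 where "x0 = x(n := sgn (x n))"
      have x0n: "norm (x0 n) = 1" using \<open>x n \<noteq> 0\<close> by (simp add: x0_def norm_sgn)
      have x0: "norm (x0 m) \<le> 1" for m using x1 by (auto simp: x0_def norm_sgn)
      have x0v: "x0 \<in> vecs X" using upd x by (auto simp: x0_def unit_sphere_def)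
      have "nrm X x0 = 1"
        using nrm_le[of x0, OF x0] le_nrm[OF bddm[of x0, OF x0], of n] x0n by linarith
      then have x0s: "x0 \<in> unit_sphere X" using x0v by (simp add: unit_sphere_def)
      have \<alpha>x0: "norm (\<alpha> m * x0 m) \<le> 1" for m
        using \<alpha>[of m] \<beta> x0[of m] by (auto simp: norm_mult intro!: mult_le_one)
      have "nrm X (\<lambda>n. \<alpha> n * x0 n) = 1"
        using nrm_le[of "\<lambda>n. \<alpha> n * x0 n", OF \<alpha>x0] x0n \<alpha>n
          le_nrm[OF bddm[of "\<lambda>n. \<alpha> n * x0 n", OF \<alpha>x0], of n]
        by (simp add: norm_mult)
      moreover have "norm (x0 m - x m) \<le> \<epsilon>/2" for m
      proof (cases "m = n")
        case True
        have "sgn (x n) - x n = (1 - norm (x n)) *\<^sub>R sgn (x n)"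
          using \<open>x n \<noteq> 0\<close> by (simp add: sgn_div_norm algebra_simps)
        then have "norm (x0 n - x n) = 1 - norm (x n)"
          using x1[of n] \<open>x n \<noteq> 0\<close> by (simp add: x0_def norm_sgn)
        then show ?thesis
          using xn min.cobounded1[of "\<epsilon>/2" "(1 - \<beta>) / 2"] unfolding True by linarith
      qed (use \<open>0 < \<epsilon>\<close> in \<open>simp add: x0_def\<close>)
      then have "nrm X (x0 - x) < \<epsilon>"
        using nrm_le[of "x0 - x" "\<epsilon>/2"] \<open>0 < \<epsilon>\<close> by (simp add: fun_diff_def)
      ultimately show "\<exists>x0\<in>unit_sphere X. nrm X (\<lambda>n. \<alpha> n * x0 n) = 1 \<and> nrm X (x0 - x) < \<epsilon>"
        using x0s by blast
    qed
  qed (rule unit)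
qed

lemma unit_seq_tendsto_0: "(unit_seq n :: nat \<Rightarrow> 'a::real_normed_field) \<longlonglongrightarrow> 0"
  by (rule tendsto_eventually)
    (auto simp: unit_seq_def eventually_sequentially intro!: exI[where x = "Suc n"])

lemma c0_diagonal_space: "diagonal_space (c0_space :: ('a::real_normed_field, nat \<Rightarrow> 'a) nspace)"
proof (rule sup_diagonal_space)
  show "x(n := c) \<in> vecs c0_space" if "x \<in> vecs c0_space" for x :: "nat \<Rightarrow> 'a" and n c
  proof -
    have "\<forall>\<^sub>F m in sequentially. x m = (x(n := c)) m"
      using eventually_gt_at_top[of n] by eventually_elim simp
    then show ?thesis using that tendsto_cong[of x "x(n := c)"] by (simp add: c0_space_def)
  qed
qed (auto simp: c0_space_def unit_seq_tendsto_0 intro: convergent_imp_bounded)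

lemma linf_diagonal_space: "diagonal_space (lp_space \<infinity> :: ('a::real_normed_field, nat \<Rightarrow> 'a) nspace)"
proof (rule sup_diagonal_space)
  show "x(n := c) \<in> vecs (lp_space \<infinity>)" if "x \<in> vecs (lp_space \<infinity>)" for x :: "nat \<Rightarrow> 'a" and n c
  proof -
    have "range (x(n := c)) \<subseteq> insert c (range x)" by auto
    then show ?thesis using that bounded_subset[of "insert c (range x)"] by (simp add: lp_space_def)
  qed
qed (auto simp: lp_space_def intro: convergent_imp_bounded[OF unit_seq_tendsto_0])

section \<open>The p-norm for finite p\<close>

text \<open>The computations use \<open>S\<close>, the \<open>q\<close>-th power of the norm,
  because it splits additively into the mass on \<open>J\<close> and the mass off \<open>J\<close>.
  The facts \<open>nrm_powr\<close>, \<open>nrm_1\<close> and \<open>nrm_less\<close> translate back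
  to the norm.\<close>

lemma lp_diagonal_space:
  assumes q: "1 \<le> q"
  shows "diagonal_space (lp_space (ereal q) :: ('a::real_normed_field, nat \<Rightarrow> 'a) nspace)"
proof -
  define X :: "('a, nat \<Rightarrow> 'a) nspace" where "X = lp_space (ereal q)"
  define S where "S x = (\<Sum>n. norm (x n) powr q)" for x :: "nat \<Rightarrow> 'a"
  have vecs: "x \<in> vecs X \<longleftrightarrow> summable (\<lambda>n. norm (x n) powr q)" for x
    by (simp add: X_def lp_space_def)
  have nrm: "nrm X x = S x powr (1/q)" for x
    by (simp add: X_def lp_space_def S_def)
  have S_nonneg: "0 \<le> S x" if "x \<in> vecs X" for x
    unfolding S_def using that by (intro suminf_nonneg) (auto simp: vecs)
  have nrm_powr: "nrm X x powr q = S x" if "x \<in> vecs X" for x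
    using S_nonneg[OF that] q by (simp add: nrm powr_powr)
  have nrm_nonneg: "0 \<le> nrm X x" for x by (simp add: nrm)
  have nrm_1: "nrm X x = 1 \<longleftrightarrow> S x = 1" if "x \<in> vecs X" for x
    using nrm_powr[OF that] by (auto simp: nrm)
  have nrm_less: "nrm X x < c \<longleftrightarrow> S x < c powr q" if "x \<in> vecs X" "0 \<le> c" for x c
    using nrm_powr[OF that(1)] nrm_nonneg[of x] that(2) q
      powr_less_mono2[of q "nrm X x" c] powr_mono2[of q c "nrm X x"]
    by (cases "nrm X x < c") auto
  \<comment> \<open>Coordinatewise domination gives membership and estimate together. It is used
    with \<open>c = 1\<close> for truncation to \<open>J\<close> and for multipliers bounded by 1,
    and with \<open>c = \<beta> powr q\<close> for \<open>contraction\<close>.\<close>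
  have dom: "x \<in> vecs X" "S x \<le> c * S y"
    if "y \<in> vecs X" "\<And>n. norm (x n) powr q \<le> c * norm (y n) powr q" for x y c
  proof -
    have sy: "summable (\<lambda>n. norm (y n) powr q)" using that(1) by (simp add: vecs)
    have "summable (\<lambda>n. norm (x n) powr q)"
      by (rule summable_comparison_test'[OF summable_mult[OF sy, of c]]) (use that(2) in auto)
    then show "x \<in> vecs X" by (simp add: vecs)
    with that(2) show "S x \<le> c * S y"
      unfolding S_def suminf_mult[OF sy, symmetric]
      by (intro suminf_le summable_mult sy) (auto simp: vecs)
  qed
  have mult_le: "norm (a * b) powr q \<le> \<beta> powr q * norm b powr q"
    if "norm a \<le> \<beta>" for a b :: 'a and \<beta>
    using that q by (auto simp: norm_mult powr_mult intro!: mult_right_mono powr_mono2)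
  \<comment> \<open>Bounding a difference by twice the larger modulus gives summability without
    Minkowski's inequality.\<close>
  have diff: "x - y \<in> vecs X" if "x \<in> vecs X" "y \<in> vecs X" for x y
  proof -
    have *: "norm (x n - y n) powr q \<le> 2 powr q * (norm (x n) powr q + norm (y n) powr q)" for n
    proof -
      have "norm (x n - y n) \<le> 2 * max (norm (x n)) (norm (y n))"
        using norm_triangle_ineq4[of "x n" "y n"] by linarith
      then have "norm (x n - y n) powr q \<le> (2 * max (norm (x n)) (norm (y n))) powr q"
        using q by (intro powr_mono2) auto
      also have "\<dots> = 2 powr q * max (norm (x n)) (norm (y n)) powr q"
        by (simp add: powr_mult)
      also have "\<dots> \<le> 2 powr q * (norm (x n) powr q + norm (y n) powr q)"
        by (intro mult_left_mono) (auto simp: max_def)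
      finally show ?thesis .
    qed
    have "summable (\<lambda>n. 2 powr q * (norm (x n) powr q + norm (y n) powr q))"
      using that by (intro summable_mult summable_add) (simp_all add: vecs)
    from summable_comparison_test'[OF this, of 0 "\<lambda>n. norm (x n - y n) powr q"] * show ?thesis
      by (simp add: vecs)
  qed
  have coord: "norm (x n) \<le> nrm X x" if "x \<in> vecs X" for x n
  proof -
    have "(\<Sum>i\<in>{n}. norm (x i) powr q) \<le> S x"
      unfolding S_def using that by (intro sum_le_suminf) (auto simp: vecs)
    then have "(norm (x n) powr q) powr (1/q) \<le> S x powr (1/q)"
      using q by (intro powr_mono2) auto
    then show ?thesis using q by (simp add: nrm powr_powr)
  qed
  have unit_sums: "(\<lambda>m. norm (c * unit_seq n m) powr q) sums (norm c powr q)" for c :: 'a and n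
  proof -
    have "(\<lambda>m. norm (c * unit_seq n m) powr q) = (\<lambda>m. if m = n then norm c powr q else 0)"
      by (auto simp: unit_seq_def)
    then show ?thesis using sums_single[of n "\<lambda>_. norm c powr q"] by simp
  qed
  have "diagonal_space X"
  proof
    show "unit_seq n \<in> vecs X" for n
      using unit_sums[of 1 n] by (simp add: vecs sums_iff)
    show "nrm X (\<lambda>m. c * unit_seq n m) = norm c" for c n
      using unit_sums[of c n] q by (simp add: nrm S_def sums_iff powr_powr)
    show "norm (x n - y n) \<le> nrm X (x - y)" if "x \<in> vecs X" "y \<in> vecs X" for x y n
      using coord[OF diff[OF that], of n] by simp
    show "0 \<le> nrm X x" for x by (rule nrm_nonneg)
    show "nrm X (\<lambda>n. \<alpha> n * x n) \<le> \<beta> * nrm X x"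
      if "x \<in> vecs X" "0 \<le> \<beta>" "\<And>n. norm (\<alpha> n) \<le> \<beta>" for x \<alpha> \<beta>
    proof -
      have *: "(\<lambda>n. \<alpha> n * x n) \<in> vecs X" "S (\<lambda>n. \<alpha> n * x n) \<le> \<beta> powr q * S x"
        using dom[OF that(1), of "\<lambda>n. \<alpha> n * x n" "\<beta> powr q"] mult_le that(3) by auto
      then have "S (\<lambda>n. \<alpha> n * x n) powr (1/q) \<le> (\<beta> powr q * S x) powr (1/q)"
        using q S_nonneg by (intro powr_mono2) auto
      then show ?thesis using that(2) q S_nonneg[OF that(1)] by (simp add: nrm powr_mult powr_powr)
    qed
    show "nrm X (\<lambda>m. \<alpha> m * x m) < 1"
      if x: "x \<in> unit_sphere X" and \<alpha>: "\<And>m. norm (\<alpha> m) \<le> 1" "norm (\<alpha> n) < 1"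
        and near: "\<And>m. norm (x m - unit_seq n m) \<le> 1/2" for x \<alpha> n
    proof -
      have xv: "x \<in> vecs X" and Sx: "S x = 1"
        using x nrm_1 by (auto simp: unit_sphere_def)
      have le: "norm (\<alpha> m * x m) powr q \<le> 1 * norm (x m) powr q" for m
        using mult_le[OF \<alpha>(1), of m "x m"] by simp
      then have \<alpha>x: "(\<lambda>m. \<alpha> m * x m) \<in> vecs X" by (rule dom(1)[OF xv])
      \<comment> \<open>Coordinate \<open>n\<close> of \<open>x\<close> lies within 1/2 of 1. Being
        nonzero, it strictly loses mass under \<alpha>, while no other coordinate gains any.\<close>
      have "x n \<noteq> 0" using near[of n] by (auto simp: unit_seq_def)
      then have "norm (\<alpha> n * x n) < norm (x n)" using \<alpha>(2) by (simp add: norm_mult)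
      then have "norm (\<alpha> n * x n) powr q < norm (x n) powr q"
        using q by (intro powr_less_mono2) auto
      then have "0 < (\<Sum>m. norm (x m) powr q - norm (\<alpha> m * x m) powr q)"
        using le xv \<alpha>x by (intro suminf_pos2[where i = n] summable_diff) (auto simp: vecs)
      also have "\<dots> = S x - S (\<lambda>m. \<alpha> m * x m)"
        unfolding S_def using xv \<alpha>x by (intro suminf_diff[symmetric]) (auto simp: vecs)
      finally show ?thesis using nrm_less[OF \<alpha>x, of 1] Sx by simp
    qed
    show "\<exists>\<eta>>0. \<forall>x\<in>unit_sphere X. nrm X (\<lambda>n. \<alpha> n * x n) > 1 - \<eta> \<longrightarrow>
        (\<exists>x0\<in>unit_sphere X. nrm X (\<lambda>n. \<alpha> n * x0 n) = 1 \<and> nrm X (x0 - x) < \<epsilon>)"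
      if \<alpha>: "\<And>n. norm (\<alpha> n) = 1 \<or> norm (\<alpha> n) \<le> \<beta>" and \<beta>: "0 \<le> \<beta>" "\<beta> < 1" and "0 < \<epsilon>"
      for \<alpha> \<beta> \<epsilon>
    proof -
      define b where "b = \<beta> powr q"
      have b: "0 \<le> b" "b < 1"
        using \<beta> q powr_less_mono2[of q \<beta> 1] by (auto simp: b_def)
      \<comment> \<open>\<delta> will bound the mass of \<open>x\<close> off \<open>J\<close>. It is
        at most 1/2 so that the mass on \<open>J\<close> stays positive, and
        \<open>2 * \<delta>\<close> is at most \<open>\<epsilon> powr q\<close> because the final
        distance has two contributions, each below \<delta>.\<close>
      define \<delta> where "\<delta> = min (\<epsilon> powr q / 2) (1/2)"
      have \<delta>: "0 < \<delta>" "\<delta> \<le> 1/2" "2 * \<delta> \<le> \<epsilon> powr q"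
        using \<open>0 < \<epsilon>\<close> by (auto simp: \<delta>_def)
      \<comment> \<open>Mass \<delta> off \<open>J\<close> costs at least
        \<open>(1 - b) * \<delta>\<close> in the \<open>q\<close>-th power of the norm. The next
        choice of \<eta> makes \<open>(1 - \<eta>) powr q\<close> equal to
        \<open>1 - c\<close>.\<close>
      define c where "c = (1 - b) * \<delta>"
      have c: "0 < c" "c < 1"
        using b \<delta> mult_le_one[of "1 - b" "2 * \<delta>"] by (auto simp: c_def)
      define \<eta> where "\<eta> = 1 - (1 - c) powr (1/q)"
      have "0 < \<eta>"
        using c q powr_less_mono2[of "1/q" "1 - c" 1] by (simp add: \<eta>_def)
      moreover have "\<exists>x0\<in>unit_sphere X. nrm X (\<lambda>n. \<alpha> n * x0 n) = 1 \<and> nrm X (x0 - x) < \<epsilon>"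
        if x: "x \<in> unit_sphere X" and big: "1 - \<eta> < nrm X (\<lambda>n. \<alpha> n * x n)" for x
      proof -
        define J where "J = {n. norm (\<alpha> n) = 1}"
        define y where "y = (\<lambda>n. if n \<in> J then x n else 0)"
        have xv: "x \<in> vecs X" and Sx: "S x = 1"
          using x nrm_1 by (auto simp: unit_sphere_def)
        have yv: "y \<in> vecs X" and "S y \<le> 1"
          using dom[OF xv, of y 1] q Sx by (auto simp: y_def)
        have sx: "summable (\<lambda>n. norm (x n) powr q)" and sy: "summable (\<lambda>n. norm (y n) powr q)"
          using xv yv by (auto simp: vecs)
        have \<alpha>1: "norm (\<alpha> n) \<le> 1" for n using \<alpha>[of n] \<beta> by auto
        have \<alpha>xv: "(\<lambda>n. \<alpha> n * x n) \<in> vecs X"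
          using dom(1)[OF xv, of "\<lambda>n. \<alpha> n * x n" 1] mult_le[OF \<alpha>1] by auto
        \<comment> \<open>On \<open>J\<close> the coefficients \<open>b\<close> and
          \<open>1 - b\<close> add up to 1; off \<open>J\<close> the sequence \<open>y\<close>
          vanishes and the factor \<open>b\<close> remains.\<close>
        have le: "norm (\<alpha> n * x n) powr q \<le> b * norm (x n) powr q + (1 - b) * norm (y n) powr q" for n
          using \<alpha>[of n] mult_le[of "\<alpha> n" \<beta> "x n"] q
          by (cases "n \<in> J") (auto simp: J_def y_def b_def norm_mult algebra_simps)
        have "1 - c = (1 - \<eta>) powr q"
          using c q by (simp add: \<eta>_def powr_powr)
        also have "\<dots> < nrm X (\<lambda>n. \<alpha> n * x n) powr q"
          using big q c by (intro powr_less_mono2) (auto simp: \<eta>_def)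
        also have "\<dots> = S (\<lambda>n. \<alpha> n * x n)" by (rule nrm_powr[OF \<alpha>xv])
        also have "\<dots> \<le> (\<Sum>n. b * norm (x n) powr q + (1 - b) * norm (y n) powr q)"
          unfolding S_def using \<alpha>xv sx sy le
          by (intro suminf_le summable_add summable_mult) (auto simp: vecs)
        also have "\<dots> = b * S x + (1 - b) * S y"
          unfolding S_def using sx sy
          by (simp add: suminf_add[symmetric] suminf_mult summable_mult)
        finally have "(1 - b) * (1 - S y) < (1 - b) * \<delta>"
          by (simp add: Sx c_def algebra_simps)
        then have Sy: "1 - S y < \<delta>" using b by simp
        \<comment> \<open>\<open>t\<close> is the norm of \<open>y\<close>. Since
          \<open>S y \<le> t\<close>, the estimate \<open>1 - S y < \<delta>\<close> also gives
          \<open>1 - t < \<delta>\<close>.\<close>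
        define t where "t = S y powr (1/q)"
        have t: "0 < t" "t \<le> 1" "t powr q = S y" "S y \<le> t"
        proof -
          have "0 < S y" using Sy \<delta> by simp
          then show "0 < t" by (simp add: t_def)
          show "t powr q = S y" using \<open>0 < S y\<close> q by (simp add: t_def powr_powr)
          show "t \<le> 1" using \<open>S y \<le> 1\<close> \<open>0 < S y\<close> q by (simp add: t_def powr_le1)
          show "S y \<le> t"
            using powr_mono'[of "1/q" 1 "S y"] \<open>S y \<le> 1\<close> \<open>0 < S y\<close> q by (simp add: t_def)
        qed
        define x0 where "x0 = (\<lambda>n. y n /\<^sub>R t)"
        have nx0: "norm (x0 n) powr q = norm (y n) powr q / S y" for n
        proof -
          have "norm (x0 n) = norm (y n) / t"
            using t by (simp add: x0_def field_simps)
          then show ?thesis using t by (simp add: powr_divide)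
        qed
        have "S y \<noteq> 0" using Sy \<delta> by simp
        have x0_sums: "(\<lambda>n. norm (x0 n) powr q) sums 1"
          using sums_divide[OF summable_sums[OF sy], of "S y"] \<open>S y \<noteq> 0\<close>
          by (simp add: nx0 flip: S_def)
        then have x0v: "x0 \<in> vecs X" and "S x0 = 1" by (auto simp: vecs S_def sums_iff)
        have \<alpha>x0: "norm (\<alpha> n * x0 n) = norm (x0 n)" for n
          by (simp add: norm_mult x0_def y_def J_def)
        have \<alpha>x0v: "(\<lambda>n. \<alpha> n * x0 n) \<in> vecs X" and "S (\<lambda>n. \<alpha> n * x0 n) = 1"
          using x0v \<open>S x0 = 1\<close> by (auto simp: vecs S_def \<alpha>x0)
        \<comment> \<open>On \<open>J\<close> only the first summand survives, the cost of
          rescaling; off \<open>J\<close> only the bracket does, the cost of truncation.\<close>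
        have nd: "norm ((x0 - x) n) powr q =
            (1/t - 1) powr q * norm (y n) powr q + (norm (x n) powr q - norm (y n) powr q)" for n
        proof (cases "n \<in> J")
          case True
          have "x0 n - x n = (1/t - 1) *\<^sub>R x n"
            using True by (simp add: x0_def y_def algebra_simps divide_inverse)
          then have "norm (x0 n - x n) = (1/t - 1) * norm (x n)"
            using t by simp
          then show ?thesis using True t by (simp add: powr_mult y_def)
        next
          case False
          then show ?thesis using q by (simp add: x0_def y_def)
        qed
        have "S (x0 - x) = (1/t - 1) powr q * S y + (S x - S y)"
          unfolding S_def nd using sx sy
          by (simp add: suminf_add[symmetric] suminf_diff[symmetric] suminf_mult summable_mult summable_diff)
        also have "(1/t - 1) powr q * S y = ((1/t - 1) * t) powr q"
          using t by (simp add: powr_mult)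
        also have "(1/t - 1) * t = 1 - t" using t by (simp add: field_simps)
        \<comment> \<open>As \<open>1 - t\<close> lies between 0 and 1 and \<open>q\<close> is at
          least 1, the power does not exceed its base. The total is then at most
          \<open>(1 - t) + (1 - S y)\<close>, below \<open>2 * \<delta>\<close>.\<close>
        also have "(1 - t) powr q \<le> 1 - t"
          using powr_mono'[of 1 q "1 - t"] t q by simp
        finally have "S (x0 - x) < \<epsilon> powr q" using t Sy Sx \<delta> by linarith
        then have "nrm X (x0 - x) < \<epsilon>"
          using nrm_less[OF diff[OF x0v xv]] \<open>0 < \<epsilon>\<close> by simp
        then show ?thesis
          using x0v \<open>S x0 = 1\<close> \<alpha>x0v \<open>S (\<lambda>n. \<alpha> n * x0 n) = 1\<close> nrm_1
          by (auto simp: unit_sphere_def intro!: bexI[where x = x0])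
      qed
      ultimately show ?thesis by blast
    qed
  qed
  then show ?thesis by (simp add: X_def)
qed

theorem theorem2p13:
  fixes X :: "('a::real_normed_field, nat \<Rightarrow> 'a) nspace"
    and \<alpha> :: "nat \<Rightarrow> 'a"
    and T :: "(nat \<Rightarrow> 'a) \<Rightarrow> (nat \<Rightarrow> 'a)"
  assumes X: "X = c0_space \<or> (\<exists>p::ereal. 1 \<le> p \<and> X = lp_space p)"
    and \<alpha>: "bounded (range \<alpha>)"
    and T: "T \<in> bounded_operators X X"
    and T_diag: "\<forall>x\<in>vecs X. T x = (\<lambda>n. \<alpha> n * x n)"
    and T_norm: "op_norm X X T = 1"
  shows "T \<in> A_norm X X \<longleftrightarrow>
    (\<exists>n0. norm (\<alpha> n0) = 1) \<and>
    (let J = {n. norm (\<alpha> n) = 1} in J = UNIV \<or> (SUP n\<in>UNIV - J. norm (\<alpha> n)) < 1)"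
proof -
  \<comment> \<open>An extended real \<open>p\<close> with \<open>1 \<le> p\<close> is either a
    finite \<open>ereal q\<close> with \<open>1 \<le> q\<close> or infinite.\<close>
  have "diagonal_space (lp_space p :: ('a, nat \<Rightarrow> 'a) nspace)" if "1 \<le> p" for p
    using that lp_diagonal_space linf_diagonal_space by (cases p) auto
  then have "diagonal_space X" using X c0_diagonal_space by blast
  from diagonal_space.diagonal_A_norm_iff[OF this T T_diag T_norm] show ?thesis .
qed

end
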